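(* Let $\alpha\in(0,1)$, $\ell\ge0$, $\beta>0$ a constant. Suppose that $f:\mathbb{R}^d\to\mathbb{R}$ is of class $C^1$ and there is $L_f>0$ with $\|\nabla f(x)-\nabla f(y)\|\le L_f\|x-y\|$ for all $x,y\in\mathbb{R}^d$. Suppose that $\psi:[\ell,\infty)\to[0,\infty)$ is strictly increasing, of class $C^1$, with $\psi'>0$ and $\sup_{t\ge\ell}\psi(t)=\infty$. Then no nontrivial (i.e. non-constant) solution $z$ of $${}^{C}D_{\ell,\psi}^{\alpha}z(t)=-\beta\nabla f(z(t))\quad(t\ge\ell),\qquad z(\ell)=z_0\in\mathbb{R}^d,$$ converges to a stationary point at an exponential rate; that is, there are no $y_*\in\mathbb{R}^d$ with $\nabla f(y_* )=0$ and $\omega>0$ such that $\|z(t)-y_*\|=O(e^{-\omega\psi(t)})$ as $t\to\infty$.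
   Context: For $0<\gamma\le 1$, the $\psi$-Riemann-Liouville integral is $(I_{\ell,\psi}^{\gamma}x)(t)=\frac{1}{\Gamma(\gamma)}\int_\ell^t(\psi(t)-\psi(\tau))^{\gamma-1}\psi'(\tau)x(\tau)\,d\tau$. For $0<\alpha<1$ the $\psi$-Caputo fractional derivative is ${}^{C}D_{\ell,\psi}^{\alpha}=I_{\ell,\psi}^{1-\alpha}\circ J_\psi$, where $J_\psi=\frac{1}{\psi'(t)}\frac{d}{dt}$. For vector-valued functions these are applied componentwise. A solution is a continuous function satisfying the equation for every $t\ge\ell$ together with the initial condition; equivalently, it satisfies $z(t)=z_0-\frac{\beta}{\Gamma(\alpha)}\int_\ell^t(\psi(t)-\psi(s))^{\alpha-1}\psi'(s)\nabla f(z(s))\,ds$ for $t\ge\ell$. $\|\cdot\|$ is the Euclidean norm. *)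

theory Defs
  imports "HOL-Analysis.Analysis" "HOL-Library.Landau_Symbols"
begin

text \<open>
  Functions on the half-line \<open>[l, \<infinity>)\<close> are represented by total functions on the reals. All
  derivatives are taken within \<open>{l..}\<close>, hence one-sided at \<open>l\<close>, so values to the left of \<open>l\<close>
  are irrelevant.
\<close>

definition halfline_deriv :: "real \<Rightarrow> (real \<Rightarrow> 'a::real_normed_vector) \<Rightarrow> real \<Rightarrow> 'a" where
  "halfline_deriv l x t = vector_derivative x (at t within {l..})"

definition C1_on_halfline :: "real \<Rightarrow> (real \<Rightarrow> real) \<Rightarrow> bool" where
  "C1_on_halfline l \<psi> \<longleftrightarrow>
     \<psi> differentiable_on {l..} \<and> continuous_on {l..} (halfline_deriv l \<psi>)"

definition psi_RL_integrand ::
  "real \<Rightarrow> (real \<Rightarrow> real) \<Rightarrow> real \<Rightarrow> (real \<Rightarrow> 'a::real_normed_vector) \<Rightarrow> real \<Rightarrow> real \<Rightarrow> 'a" where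
  "psi_RL_integrand l \<psi> \<gamma> x t \<tau> =
     ((\<psi> t - \<psi> \<tau>) powr (\<gamma> - 1) * halfline_deriv l \<psi> \<tau>) *\<^sub>R x \<tau>"

text \<open>The integral is a vector-valued Lebesgue integral, i.e. it acts componentwise.\<close>

definition psi_RL_integral ::
  "real \<Rightarrow> (real \<Rightarrow> real) \<Rightarrow> real \<Rightarrow> (real \<Rightarrow> 'a::euclidean_space) \<Rightarrow> real \<Rightarrow> 'a" where
  "psi_RL_integral l \<psi> \<gamma> x t =
     (1 / Gamma \<gamma>) *\<^sub>R set_lebesgue_integral lebesgue {l..t} (psi_RL_integrand l \<psi> \<gamma> x t)"

definition J_psi ::
  "real \<Rightarrow> (real \<Rightarrow> real) \<Rightarrow> (real \<Rightarrow> 'a::real_normed_vector) \<Rightarrow> real \<Rightarrow> 'a" where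
  "J_psi l \<psi> x t = (1 / halfline_deriv l \<psi> t) *\<^sub>R halfline_deriv l x t"

definition psi_Caputo_deriv ::
  "real \<Rightarrow> (real \<Rightarrow> real) \<Rightarrow> real \<Rightarrow> (real \<Rightarrow> 'a::euclidean_space) \<Rightarrow> real \<Rightarrow> 'a" where
  "psi_Caputo_deriv l \<psi> \<alpha> x = psi_RL_integral l \<psi> (1 - \<alpha>) (J_psi l \<psi> x)"

text \<open>
  The operators above are total, so the existence of the Caputo derivative at \<open>t\<close> has to be
  required separately. Differentiability is not required at \<open>l\<close> itself: solutions behave
  like \<open>z\<^sub>0 + c (\<psi> t - \<psi> l)\<^sup>\<alpha>\<close> there, and a single point does not affect the integral.
\<close>

definition psi_Caputo_deriv_exists ::
  "real \<Rightarrow> (real \<Rightarrow> real) \<Rightarrow> real \<Rightarrow> (real \<Rightarrow> 'a::euclidean_space) \<Rightarrow> real \<Rightarrow> bool" where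
  "psi_Caputo_deriv_exists l \<psi> \<alpha> x t \<longleftrightarrow>
     x differentiable_on {l<..t} \<and>
     psi_RL_integrand l \<psi> (1 - \<alpha>) (J_psi l \<psi> x) t absolutely_integrable_on {l..t}"

text \<open>
  At \<open>t = l\<close> the integral over \<open>{l..l}\<close> is \<open>0\<close>, so the differential equation read literally there
  would force \<open>g z\<^sub>0 = 0\<close> and hence a constant solution. It is therefore imposed
  for \<open>t > l\<close>, which is the weaker requirement.
\<close>

definition is_Caputo_solution ::
  "real \<Rightarrow> (real \<Rightarrow> real) \<Rightarrow> real \<Rightarrow> real \<Rightarrow> ('a::euclidean_space \<Rightarrow> 'a) \<Rightarrow> 'a \<Rightarrow> (real \<Rightarrow> 'a) \<Rightarrow> bool"
where
  "is_Caputo_solution l \<psi> \<alpha> \<beta> g z\<^sub>0 z \<longleftrightarrow>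
     continuous_on {l..} z \<and> z l = z\<^sub>0 \<and>
     (\<forall>t>l. psi_Caputo_deriv_exists l \<psi> \<alpha> z t \<and>
            psi_Caputo_deriv l \<psi> \<alpha> z t = - (\<beta> *\<^sub>R g (z t)))"

text \<open>
  The equivalent Volterra form; the initial condition is the equation at \<open>t = l\<close>, and the
  integrals exist since \<open>g \<circ> z\<close> is continuous.
\<close>

definition is_integral_solution ::
  "real \<Rightarrow> (real \<Rightarrow> real) \<Rightarrow> real \<Rightarrow> real \<Rightarrow> ('a::euclidean_space \<Rightarrow> 'a) \<Rightarrow> 'a \<Rightarrow> (real \<Rightarrow> 'a) \<Rightarrow> bool"
where
  "is_integral_solution l \<psi> \<alpha> \<beta> g z\<^sub>0 z \<longleftrightarrow>
     continuous_on {l..} z \<and>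
     (\<forall>t\<ge>l. z t = z\<^sub>0 - \<beta> *\<^sub>R psi_RL_integral l \<psi> \<alpha> (\<lambda>s. g (z s)) t)"

end

theory Submission
  imports Defs
begin

text \<open>
  The reason is that memory of a nonzero starting displacement fades only algebraically, so an
  exponentially decaying solution can have no displacement at all. Measure time by
  \<open>s = \<psi> t - \<psi> l\<close> and put \<open>w s = z t - y\<close> for the stationary point \<open>y\<close>. The equation becomes the
  classical Abel--Volterra equation
  \<open>w s = w\<^sub>0 + (\<integral>r=0..s. (s - r) powr (\<alpha> - 1) *\<^sub>R h r)\<close>, where
  \<open>h s = - (\<beta> / Gamma \<alpha>) *\<^sub>R grad_f (y + w s)\<close>. Since \<open>grad_f y = 0\<close>, the Lipschitz condition gives
  \<open>norm (h s) \<le> K * norm (w s)\<close>, and exponential convergence means \<open>w s = O(exp (- \<omega> * s))\<close>.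

  Then \<open>h\<close> decays exponentially as well, and so its Abel integral tends to \<open>0\<close>
  (\<open>abel_integral_exp_decay\<close>). Letting \<open>s \<rightarrow> \<infinity>\<close> in the Volterra equation yields \<open>w\<^sub>0 = 0\<close>: the solution
  starts at the stationary point. The remaining homogeneous equation has only the zero solution,
  by a Gronwall argument with an exponential weight (\<open>abel_gronwall_zero\<close>). Hence \<open>z\<close> is constant.

  Two reductions lead to this equation. The substitution along \<open>\<psi>\<close> turns the \<open>\<psi>\<close>-Riemann--Liouville
  integrals into Abel integrals (\<open>psi_RL_integral_eq_abel\<close>). For a solution in the Caputo sense,
  the Volterra form is recovered by applying the Abel integral of order \<open>\<alpha>\<close> to both sides: by
  Fubini and Euler's Beta integral, the integral of order \<open>\<alpha>\<close> of the integral of order \<open>1 - \<alpha>\<close> of \<open>w'\<close>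
  is a multiple of the plain integral of \<open>w'\<close> (\<open>caputo_imp_volterra\<close>).
\<close>

section \<open>Abel integrals\<close>

text \<open>
  Trading an exponential for a negative power keeps every integral below a Beta integral: with a
  power close to \<open>1\<close> this captures decay at infinity, with a small power it brings out the
  smallness of an integral with a strong exponential weight.
\<close>

lemma exp_minus_le_powr:
  fixes a x :: real
  assumes "0 \<le> a" "a \<le> 1" "0 < x"
  shows "exp (- x) \<le> x powr (- a)"
proof -
  have "x powr a \<le> 1 + x"
  proof (cases "x \<le> 1")
    case True
    then have "x powr a \<le> 1" using assms by (simp add: powr_le1)
    then show ?thesis using assms by simp
  next
    case False
    then have "x powr a \<le> x powr 1" using assms by (intro powr_mono) auto
    then show ?thesis using assms by simp
  qed
  also have "\<dots> \<le> exp x" by (rule exp_ge_add_one_self)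
  finally show ?thesis
    using assms by (simp add: exp_minus powr_minus le_imp_inverse_le)
qed

text \<open>
  Euler's Beta integral, carried from the unit interval to \<open>{q..s}\<close> by \<open>r = q + (s - q) * u\<close>.
\<close>

lemma has_integral_Beta_interval:
  fixes a b q s :: real
  assumes "0 < a" "0 < b" "q < s"
  shows "((\<lambda>r. (s - r) powr (a - 1) * (r - q) powr (b - 1))
            has_integral Beta a b * (s - q) powr (a + b - 1)) {q..s}"
proof -
  let ?d = "s - q"
  let ?m = "1 / ?d"
  have d: "?d > 0" using assms by simp
  have "((\<lambda>u. u powr (b - 1) * (1 - u) powr (a - 1)) has_integral Beta b a) (cbox 0 1)"
    using has_integral_Beta_real[OF assms(2,1)] by simp
  from has_integral_affinity'[OF this, of ?m "- q / ?d"]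
  have "((\<lambda>r. (?m * r + - q / ?d) powr (b - 1) * (1 - (?m * r + - q / ?d)) powr (a - 1))
      has_integral Beta b a /\<^sub>R ?m) {(0 - - q / ?d) /\<^sub>R ?m..(1 - - q / ?d) /\<^sub>R ?m}"
    using d by simp
  moreover have "(0 - - q / ?d) /\<^sub>R ?m = q" "(1 - - q / ?d) /\<^sub>R ?m = s"
    "Beta b a /\<^sub>R ?m = ?d * Beta b a"
    using d by (simp_all add: field_simps)
  ultimately have "((\<lambda>r. (?m * r + - q / ?d) powr (b - 1) * (1 - (?m * r + - q / ?d)) powr (a - 1))
      has_integral ?d * Beta b a) {q..s}"
    by simp
  then have "((\<lambda>r. ?d powr (a + b - 2) *
      ((?m * r + - q / ?d) powr (b - 1) * (1 - (?m * r + - q / ?d)) powr (a - 1)))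
      has_integral ?d powr (a + b - 2) * (?d * Beta b a)) {q..s}"
    by (rule has_integral_mult_right)
  moreover have "?d powr (a + b - 2) *
      ((?m * r + - q / ?d) powr (b - 1) * (1 - (?m * r + - q / ?d)) powr (a - 1))
      = (s - r) powr (a - 1) * (r - q) powr (b - 1)" if "r \<in> {q..s}" for r
  proof -
    have e1: "?m * r + - q / ?d = (r - q) / ?d" by (simp add: diff_divide_distrib)
    have e2: "1 - (r - q) / ?d = (s - r) / ?d" using d by (simp add: field_simps)
    have e3: "?d powr (a + b - 2) = ?d powr (a - 1) * ?d powr (b - 1)"
      by (simp flip: powr_add)
    show ?thesis unfolding e1 e2 e3 using d that by (simp add: powr_divide)
  qed
  moreover have "?d powr (a + b - 2) * (?d * Beta b a) = Beta a b * ?d powr (a + b - 1)"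
  proof -
    have "?d powr (a + b - 1) = ?d powr ((a + b - 2) + 1)" by simp
    also have "\<dots> = ?d powr (a + b - 2) * ?d" unfolding powr_add using d by simp
    finally show ?thesis by (simp add: Beta_commute)
  qed
  ultimately show ?thesis by (metis (no_types, lifting) has_integral_cong)
qed

lemma has_integral_abel_kernel:
  fixes a s :: real
  assumes "0 < a" "0 < s"
  shows "((\<lambda>r. (s - r) powr (a - 1)) has_integral Beta a 1 * s powr a) {0..s}"
proof -
  \<comment> \<open>The factor \<open>r powr 0\<close> is \<open>1\<close> except at \<open>r = 0\<close>, hence the open interval.\<close>
  have "((\<lambda>r. (s - r) powr (a - 1) * (r - 0) powr (1 - 1)) has_integral
      Beta a 1 * (s - 0) powr (a + 1 - 1)) {0<..<s}"
    using has_integral_Beta_interval[OF assms(1) zero_less_one assms(2)]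
    unfolding has_integral_Icc_iff_Ioo .
  then show ?thesis unfolding has_integral_Icc_iff_Ioo
    by (rule has_integral_eq_rhs[OF has_integral_eq[rotated]]) auto
qed

text \<open>
  This is the classical Riemann--Liouville integral without the factor \<open>1 / Gamma a\<close>. The factor is
  left out so that it can be absorbed into \<open>h\<close> where only sizes matter.
\<close>

definition abel_integral :: "real \<Rightarrow> (real \<Rightarrow> 'a::euclidean_space) \<Rightarrow> real \<Rightarrow> 'a" where
  "abel_integral a h s = integral {0..s} (\<lambda>r. (s - r) powr (a - 1) *\<^sub>R h r)"

lemma abel_integral_scaleR:
  "abel_integral a (\<lambda>r. c *\<^sub>R h r) s = c *\<^sub>R abel_integral a h s"
  unfolding abel_integral_def by (subst scaleR_left_commute) (rule integral_cmul)

lemma abel_integrand_absolutely_integrable: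
  fixes h :: "real \<Rightarrow> 'a::euclidean_space"
  assumes "0 < a" "0 \<le> s" "continuous_on {0..s} h"
  shows "(\<lambda>r. (s - r) powr (a - 1) *\<^sub>R h r) absolutely_integrable_on {0..s}"
proof (cases "s = 0")
  case True
  then show ?thesis
    by (intro absolutely_integrable_negligible) simp
next
  case False
  have k: "(\<lambda>r. (s - r) powr (a - 1)) absolutely_integrable_on {0..s}"
    using has_integral_abel_kernel[OF assms(1), of s] assms False
    by (intro nonnegative_absolutely_integrable_1) (auto simp: has_integral_integrable_integral)
  have "bilinear (\<lambda>(x::'a) (c::real). c *\<^sub>R x)"
    by (auto simp: bilinear_def linear_iff algebra_simps)
  then show ?thesis
  proof (rule absolutely_integrable_bounded_measurable_product[OF _ _ _ _ k])
    show "h \<in> borel_measurable (lebesgue_on {0..s})"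
      by (rule continuous_imp_measurable_on_sets_lebesgue[OF assms(3)]) auto
    show "bounded (h ` {0..s})"
      by (intro compact_imp_bounded compact_continuous_image assms) auto
  qed auto
qed

text \<open>
  The majorant \<open>g\<close> will be a negative power. Since \<open>0 powr c = 0\<close>, such a power is no majorant at its
  singularity, so the bound is required only inside the interval.
\<close>

lemma norm_abel_integral_le:
  fixes h :: "real \<Rightarrow> 'a::euclidean_space"
  assumes "0 < a" "0 \<le> s" "continuous_on {0..s} h"
    and g: "((\<lambda>r. (s - r) powr (a - 1) * g r) has_integral B) {0..s}"
    and "\<And>r. 0 < r \<Longrightarrow> r < s \<Longrightarrow> norm (h r) \<le> g r"
  shows "norm (abel_integral a h s) \<le> B"
proof -
  have "abel_integral a h s = integral {0<..<s} (\<lambda>r. (s - r) powr (a - 1) *\<^sub>R h r)"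
    by (simp add: abel_integral_def integral_open_interval_real)
  also have "norm \<dots> \<le> integral {0<..<s} (\<lambda>r. (s - r) powr (a - 1) * g r)"
  proof (rule integral_norm_bound_integral)
    show "(\<lambda>r. (s - r) powr (a - 1) *\<^sub>R h r) integrable_on {0<..<s}"
      using set_lebesgue_integral_eq_integral(1)[OF abel_integrand_absolutely_integrable[OF assms(1-3)]]
      by (simp add: integrable_on_Icc_iff_Ioo)
    show "(\<lambda>r. (s - r) powr (a - 1) * g r) integrable_on {0<..<s}"
      using g by (auto simp: has_integral_Icc_iff_Ioo)
  qed (auto intro!: mult_left_mono assms)
  also have "\<dots> = B" using g by (simp add: integral_unique has_integral_Icc_iff_Ioo)
  finally show ?thesis .
qed

section \<open>Exponentially decaying solutions of Volterra equations\<close>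

text \<open>
  Bounding \<open>exp (- \<omega> * r)\<close> by a multiple of \<open>r powr (- b)\<close> with \<open>a < b < 1\<close> reduces the claim to the
  Beta integral: the power is integrable at \<open>0\<close> because \<open>b < 1\<close>, and the resulting bound
  \<open>s powr (a - b)\<close> vanishes at infinity because \<open>a < b\<close>.
\<close>

lemma abel_integral_exp_decay:
  fixes h :: "real \<Rightarrow> 'a::euclidean_space"
  assumes "0 < a" "a < 1" "0 < \<omega>" and h: "continuous_on {0..} h"
    and bd: "\<And>s. 0 \<le> s \<Longrightarrow> norm (h s) \<le> C * exp (- \<omega> * s)"
  shows "(abel_integral a h \<longlongrightarrow> 0) at_top"
proof -
  define b where "b = (1 + a) / 2"
  have b: "a < b" "b < 1" "0 < b" using assms by (auto simp: b_def)
  have C: "0 \<le> C" using bd[of 0] norm_ge_zero[of "h 0"] by (simp del: norm_ge_zero)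
  define D where "D = C * \<omega> powr (- b)"
  have le: "norm (abel_integral a h s) \<le> D * (Beta a (1 - b) * s powr (a - b))" if s: "0 < s" for s
  proof (rule norm_abel_integral_le[where g = "\<lambda>r. D * r powr (- b)"])
    have "((\<lambda>r. D * ((s - r) powr (a - 1) * (r - 0) powr (1 - b - 1))) has_integral
        D * (Beta a (1 - b) * (s - 0) powr (a + (1 - b) - 1))) {0..s}"
      using assms b s by (intro has_integral_mult_right has_integral_Beta_interval) auto
    then show "((\<lambda>r. (s - r) powr (a - 1) * (D * r powr (- b))) has_integral
        D * (Beta a (1 - b) * s powr (a - b))) {0..s}"
      by (simp add: mult_ac)
  next
    fix r :: real assume r: "0 < r" "r < s"
    have "norm (h r) \<le> C * exp (- (\<omega> * r))" using bd[of r] r by simp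
    also have "\<dots> \<le> C * (\<omega> * r) powr (- b)"
      using b r assms C by (intro mult_left_mono exp_minus_le_powr) auto
    also have "\<dots> = D * r powr (- b)" using r assms by (simp add: D_def powr_mult)
    finally show "norm (h r) \<le> D * r powr (- b)" .
  qed (use assms s in \<open>auto intro: continuous_on_subset\<close>)
  have "((\<lambda>s. s powr (a - b)) \<longlongrightarrow> 0) at_top"
    using b by (intro tendsto_neg_powr filterlim_ident) auto
  then have "((\<lambda>s. D * (Beta a (1 - b) * s powr (a - b))) \<longlongrightarrow> 0) at_top"
    by (intro tendsto_mult_right_zero)
  then show ?thesis
    by (rule Lim_null_comparison[rotated])
      (use le in \<open>auto intro: eventually_mono[OF eventually_gt_at_top[of 0]]\<close>)
qed

text \<open>
  On a compact interval, let \<open>N\<close> be the maximum of \<open>exp (- \<mu> * r) * norm (w r)\<close>. In the equation at the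
  maximum point \<open>p\<close>, the weight contributes \<open>exp (- \<mu> * (p - r))\<close> under the integral. This is at most
  \<open>(\<mu> * (p - r)) powr (- a / 2)\<close>, which leaves the kernel integrable and gains the factor
  \<open>\<mu> powr (- a / 2)\<close>. For large \<open>\<mu>\<close> this yields \<open>N \<le> N / 2\<close>.
\<close>

lemma abel_gronwall_zero:
  fixes w h :: "real \<Rightarrow> 'a::euclidean_space"
  assumes a: "0 < a" "a < 1"
    and w: "continuous_on {0..} w" and h: "continuous_on {0..} h"
    and hw: "\<And>s. 0 \<le> s \<Longrightarrow> norm (h s) \<le> L * norm (w s)"
    and eq: "\<And>s. 0 \<le> s \<Longrightarrow> w s = abel_integral a h s"
    and "0 \<le> s"
  shows "w s = 0"
proof -
  define S where "S = max 1 s"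
  define K where "K = Beta (a / 2) 1 * S powr (a / 2)"
  \<comment> \<open>Chosen such that \<open>\<mu> powr (- a / 2) = 1 / E\<close> with \<open>max L 0 * K / E \<le> 1 / 2\<close>; the \<open>max\<close> spares a sign condition on \<open>L\<close>.\<close>
  define E where "E = 2 * (max L 0) * K + 1"
  define \<mu> where "\<mu> = E powr (2 / a)"
  have "S \<ge> 1" by (simp add: S_def)
  have "K \<ge> 0" unfolding K_def using a
    by (intro mult_nonneg_nonneg) (auto simp: Beta_def intro!: less_imp_le)
  then have "E \<ge> 1" by (simp add: E_def)
  then have lam: "\<mu> > 0" "\<mu> powr (- (a / 2)) = 1 / E"
    using a by (simp_all add: \<mu>_def powr_powr powr_minus divide_simps)
  have small: "max L 0 * (\<mu> powr (- (a / 2)) * K) \<le> 1 / 2"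
    unfolding lam using \<open>E \<ge> 1\<close> \<open>K \<ge> 0\<close> by (simp add: divide_simps) (simp add: E_def)
  let ?v = "\<lambda>r. exp (- \<mu> * r) * norm (w r)"
  have "continuous_on {0..S} ?v"
    using w by (intro continuous_intros) (auto intro: continuous_on_subset)
  then obtain p where p: "p \<in> {0..S}" "\<And>r. r \<in> {0..S} \<Longrightarrow> ?v r \<le> ?v p"
    using continuous_attains_sup[of "{0..S}" ?v] \<open>S \<ge> 1\<close> by auto
  define N where "N = ?v p"
  have "N \<ge> 0" by (simp add: N_def)
  have wN: "norm (w r) \<le> N * exp (\<mu> * r)" if "r \<in> {0..S}" for r
    using p(2)[OF that] by (simp add: N_def exp_minus field_simps)
  have "w 0 = 0" using eq[of 0] by (simp add: abel_integral_def)
  have "N \<le> N / 2"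
  proof (cases "p = 0")
    case True then show ?thesis using \<open>w 0 = 0\<close> by (simp add: N_def)
  next
    case False
    with p have p0: "0 < p" by auto
    let ?c = "max L 0 * N * exp (\<mu> * p) * \<mu> powr (- (a / 2))"
    have "norm (abel_integral a h p) \<le> ?c * (Beta (a / 2) 1 * p powr (a / 2))"
    proof (rule norm_abel_integral_le[where g = "\<lambda>r. ?c * (p - r) powr (- (a / 2))"])
      have *: "(p - r) powr (a / 2 - 1) = (p - r) powr (a - 1) * (p - r) powr (- (a / 2))" for r
        by (simp flip: powr_add)
      have "((\<lambda>r. ?c * (p - r) powr (a / 2 - 1)) has_integral
          ?c * (Beta (a / 2) 1 * p powr (a / 2))) {0..p}"
        using a p0 by (intro has_integral_mult_right has_integral_abel_kernel) auto
      then show "((\<lambda>r. (p - r) powr (a - 1) * (?c * (p - r) powr (- (a / 2)))) has_integral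
          ?c * (Beta (a / 2) 1 * p powr (a / 2))) {0..p}"
        unfolding * by (simp add: mult_ac)
    next
      fix r assume r: "0 < r" "r < p"
      have "norm (h r) \<le> L * norm (w r)" using hw[of r] r by simp
      also have "\<dots> \<le> max L 0 * norm (w r)" by (intro mult_right_mono) auto
      also have "\<dots> \<le> max L 0 * (N * exp (\<mu> * r))"
        using wN[of r] r p by (intro mult_left_mono) auto
      also have "exp (\<mu> * r) = exp (\<mu> * p) * exp (- (\<mu> * (p - r)))"
        by (simp add: algebra_simps flip: exp_add)
      also have "max L 0 * (N * (exp (\<mu> * p) * exp (- (\<mu> * (p - r)))))
          \<le> max L 0 * (N * (exp (\<mu> * p) * (\<mu> * (p - r)) powr (- (a / 2))))"
        using r a lam \<open>N \<ge> 0\<close> by (intro mult_left_mono exp_minus_le_powr) auto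
      also have "\<dots> = ?c * (p - r) powr (- (a / 2))"
        using r lam by (simp add: powr_mult mult_ac)
      finally show "norm (h r) \<le> ?c * (p - r) powr (- (a / 2))" .
    qed (use a p h in \<open>auto intro: continuous_on_subset\<close>)
    also have "\<dots> \<le> ?c * K"
      unfolding K_def using a p lam \<open>N \<ge> 0\<close>
      by (intro mult_left_mono powr_mono2 mult_nonneg_nonneg powr_ge_zero)
         (auto simp: Beta_def intro!: less_imp_le)
    finally have "norm (w p) \<le> ?c * K" using eq[of p] p by simp
    also have "?c * K = N * exp (\<mu> * p) * (max L 0 * (\<mu> powr (- (a / 2)) * K))" by (simp add: mult_ac)
    also have "\<dots> \<le> N * exp (\<mu> * p) * (1 / 2)"
      using small \<open>N \<ge> 0\<close> by (intro mult_left_mono) auto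
    finally show ?thesis by (simp add: N_def exp_minus field_simps)
  qed
  with \<open>N \<ge> 0\<close> have "N = 0" by simp
  with wN[of s] \<open>0 \<le> s\<close> show ?thesis by (simp add: S_def)
qed

text \<open>
  The forcing term inherits the exponential decay, so both \<open>w\<close> and its Abel
  integral tend to \<open>0\<close>. This forces \<open>w\<^sub>0 = 0\<close>, and the Gronwall argument applies.
\<close>

lemma volterra_exp_decay_zero:
  fixes w h :: "real \<Rightarrow> 'a::euclidean_space"
  assumes a: "0 < a" "a < 1" and "0 < \<omega>"
    and w: "continuous_on {0..} w" and h: "continuous_on {0..} h"
    and hw: "\<And>s. 0 \<le> s \<Longrightarrow> norm (h s) \<le> L * norm (w s)"
    and eq: "\<And>s. 0 \<le> s \<Longrightarrow> w s = w\<^sub>0 + abel_integral a h s"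
    and decay: "\<And>s. 0 \<le> s \<Longrightarrow> norm (w s) \<le> M * exp (- \<omega> * s)"
    and "0 \<le> s"
  shows "w s = 0"
proof -
  have "norm (h s) \<le> max L 0 * M * exp (- \<omega> * s)" if "0 \<le> s" for s
  proof -
    have "norm (h s) \<le> max L 0 * norm (w s)"
      using hw[OF that] by (rule order_trans) (intro mult_right_mono, auto)
    also have "\<dots> \<le> max L 0 * (M * exp (- \<omega> * s))"
      using decay[OF that] by (intro mult_left_mono) auto
    finally show ?thesis by (simp add: mult_ac)
  qed
  then have "(abel_integral a h \<longlongrightarrow> 0) at_top"
    by (rule abel_integral_exp_decay[OF a \<open>0 < \<omega>\<close> h])
  then have "((\<lambda>s. w\<^sub>0 + abel_integral a h s) \<longlongrightarrow> w\<^sub>0 + 0) at_top"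
    by (intro tendsto_intros)
  moreover have "eventually (\<lambda>s. w\<^sub>0 + abel_integral a h s = w s) at_top"
    using eventually_ge_at_top[of 0] by eventually_elim (simp add: eq)
  ultimately have "(w \<longlongrightarrow> w\<^sub>0) at_top" by (simp add: filterlim_cong)
  moreover have "(w \<longlongrightarrow> 0) at_top"
  proof (rule Lim_null_comparison)
    show "eventually (\<lambda>s. norm (w s) \<le> M * exp (- \<omega> * s)) at_top"
      using eventually_ge_at_top[of 0] by eventually_elim (rule decay)
    have "filterlim (\<lambda>s. - \<omega> * s) at_bot at_top"
      using \<open>0 < \<omega>\<close> by (intro filterlim_tendsto_neg_mult_at_bot[OF tendsto_const _ filterlim_ident]) auto
    then show "((\<lambda>s. M * exp (- \<omega> * s)) \<longlongrightarrow> 0) at_top"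
      by (intro tendsto_mult_right_zero filterlim_compose[OF exp_at_bot])
  qed
  ultimately have "w\<^sub>0 = 0" by (intro tendsto_unique[OF trivial_limit_at_top_linorder])
  with eq have "\<And>s. 0 \<le> s \<Longrightarrow> w s = abel_integral a h s" by simp
  with a w h hw \<open>0 \<le> s\<close> show ?thesis by (blast intro: abel_gronwall_zero)
qed

section \<open>From the Caputo equation to the Volterra equation\<close>

text \<open>
  A derivative is a pointwise limit of difference quotients along \<open>1 / Suc n\<close>. Borel (and not only
  Lebesgue) measurability lets Fubini's theorem be used on the product of two copies of \<open>lborel\<close>.
\<close>

lemma derivative_borel_measurable:
  fixes w :: "real \<Rightarrow> 'a::euclidean_space"
  assumes w: "continuous_on {0..} w"
    and der: "\<And>s. 0 < s \<Longrightarrow> (w has_vector_derivative w' s) (at s)"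
  shows "(\<lambda>s. indicator {0<..} s *\<^sub>R w' s) \<in> borel_measurable borel"
proof (rule borel_measurable_LIMSEQ_metric)
  \<comment> \<open>A continuous extension to the whole line, with the same quotients at positive \<open>s\<close>.\<close>
  let ?W = "\<lambda>s. w (max 0 s)"
  have "continuous_on UNIV ?W"
    by (rule continuous_on_compose2[OF w]) (auto intro!: continuous_intros)
  then have [measurable]: "?W \<in> borel_measurable borel"
    by (rule borel_measurable_continuous_onI)
  show "(\<lambda>s. indicator {0<..} s *\<^sub>R (real (Suc n) *\<^sub>R (?W (s + 1 / real (Suc n)) - ?W s)))
      \<in> borel_measurable borel" for n
    by measurable
  fix s :: real
  show "(\<lambda>n. indicator {0<..} s *\<^sub>R (real (Suc n) *\<^sub>R (?W (s + 1 / real (Suc n)) - ?W s)))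
      \<longlonglongrightarrow> indicator {0<..} s *\<^sub>R w' s"
  proof (cases "0 < s")
    case True
    have "(\<lambda>h. norm (w (s + h) - w s - h *\<^sub>R w' s) / norm h) \<midarrow>0\<rightarrow> 0"
      using der[OF True] by (simp add: has_vector_derivative_def has_derivative_at)
    moreover have "(\<lambda>n. 1 / real (Suc n)) \<longlonglongrightarrow> 0"
      by (rule LIMSEQ_Suc[OF lim_1_over_n])
    then have "filterlim (\<lambda>n. 1 / real (Suc n)) (at 0) sequentially"
      by (simp add: filterlim_at)
    ultimately have "(\<lambda>n. norm (w (s + 1 / real (Suc n)) - w s - (1 / real (Suc n)) *\<^sub>R w' s)
        / norm (1 / real (Suc n))) \<longlonglongrightarrow> 0"
      by (rule filterlim_compose)
    moreover have "norm (w (s + 1 / real (Suc n)) - w s - (1 / real (Suc n)) *\<^sub>R w' s)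
        / norm (1 / real (Suc n))
        = norm (real (Suc n) *\<^sub>R (?W (s + 1 / real (Suc n)) - ?W s) - w' s)" for n
    proof -
      have *: "max 0 s = s" "max 0 (s + 1 / real (Suc n)) = s + 1 / real (Suc n)"
        using True by (auto simp: max_def add_nonneg_nonneg)
      have "real (Suc n) *\<^sub>R (?W (s + 1 / real (Suc n)) - ?W s) - w' s
          = real (Suc n) *\<^sub>R (w (s + 1 / real (Suc n)) - w s - (1 / real (Suc n)) *\<^sub>R w' s)"
        unfolding * by (simp add: scaleR_diff_right)
      then show ?thesis by (simp del: of_nat_Suc)
    qed
    ultimately have "(\<lambda>n. real (Suc n) *\<^sub>R (?W (s + 1 / real (Suc n)) - ?W s)) \<longlonglongrightarrow> w' s"
      by (simp only: tendsto_norm_zero_iff LIM_zero_iff)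
    then show ?thesis using True by simp
  qed simp
qed

text \<open>
  A Borel function has the same integral for Lebesgue measure and for its restriction \<open>lborel\<close> to the
  Borel sets. The integrals are moved to \<open>lborel\<close> because Tonelli's and Fubini's theorems are about
  product measurable functions.
\<close>

lemma absolutely_integrable_imp_lborel:
  fixes f :: "real \<Rightarrow> 'a::euclidean_space"
  assumes "f absolutely_integrable_on S" "(\<lambda>x. indicator S x *\<^sub>R f x) \<in> borel_measurable borel"
  shows "set_integrable lborel S f" "(LINT x:S|lborel. f x) = integral S f"
proof -
  show *: "set_integrable lborel S f"
    using assms integrable_completion[of "\<lambda>x. indicator S x *\<^sub>R f x" lborel]
    by (simp add: set_integrable_def)
  show "(LINT x:S|lborel. f x) = integral S f"
    by (rule set_borel_integral_eq_integral[OF *])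
qed

text \<open>
  Applying the Abel integral of order \<open>a\<close> to the hypothesis \<open>cap\<close> produces the double integral of
  \<open>(s - r) powr (a - 1) * (r - q) powr (- a) *\<^sub>R w' q\<close> over \<open>0 < q < r < s\<close>. Integrating over \<open>r\<close> first
  gives the constant \<open>Beta a (1 - a) = Gamma a * Gamma (1 - a)\<close>, independently of \<open>q\<close>; what remains
  is the integral of \<open>w'\<close>, that is \<open>w s - w 0\<close>. The derivative may be unbounded near \<open>0\<close>.
\<close>

lemma caputo_imp_volterra:
  fixes w w' h :: "real \<Rightarrow> 'a::euclidean_space"
  assumes a: "0 < a" "a < 1"
    and w: "continuous_on {0..} w"
    and der: "\<And>s. 0 < s \<Longrightarrow> (w has_vector_derivative w' s) (at s)"
    and int: "\<And>s. 0 < s \<Longrightarrow> (\<lambda>r. (s - r) powr (- a) *\<^sub>R w' r) absolutely_integrable_on {0..s}"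
    and cap: "\<And>s. 0 < s \<Longrightarrow> abel_integral (1 - a) w' s = Gamma (1 - a) *\<^sub>R h s"
    and s: "0 \<le> s"
  shows "w s = w 0 + (1 / Gamma a) *\<^sub>R abel_integral a h s"
proof (cases "s = 0")
  case True
  then show ?thesis by (simp add: abel_integral_def)
next
  case False
  with s have s: "0 < s" by simp
  define D where "D = (\<lambda>q. indicator {0<..} q *\<^sub>R w' q)"
  have [measurable]: "D \<in> borel_measurable borel"
    unfolding D_def by (rule derivative_borel_measurable[OF w der])
  define B where "B = Gamma a * Gamma (1 - a)"
  have B: "Beta a (1 - a) = B" by (simp add: B_def Beta_def)
  define k where "k = (\<lambda>q r. indicator {q<..<s} r * ((s - r) powr (a - 1) * (r - q) powr (- a)) :: real)"
  define F where "F = (\<lambda>q r. (indicator {0<..<s} q * k q r) *\<^sub>R D q)"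
  have k_alt: "k q r = (if q < r \<and> r < s then (s - r) powr (a - 1) * (r - q) powr (- a) else 0)" for q r
    by (simp add: k_def indicator_def)
  have [measurable]: "(\<lambda>(q, r). k q r) \<in> borel_measurable (borel \<Otimes>\<^sub>M borel)"
    unfolding k_alt by measurable
  have [measurable]: "(\<lambda>(q, r). F q r) \<in> borel_measurable (borel \<Otimes>\<^sub>M borel)"
    unfolding F_def by measurable
  have k_int: "integrable lborel (k q)" "(LINT r|lborel. k q r) = B" if "q < s" for q
  proof -
    have hi: "((\<lambda>r. (s - r) powr (a - 1) * (r - q) powr (- a)) has_integral B) {q<..<s}"
      using has_integral_Beta_interval[of a "1 - a" q s] that a B by (simp add: has_integral_Icc_iff_Ioo)
    then have "(\<lambda>r. (s - r) powr (a - 1) * (r - q) powr (- a)) absolutely_integrable_on {q<..<s}"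
      by (intro nonnegative_absolutely_integrable_1) auto
    from absolutely_integrable_imp_lborel[OF this] hi
    show "integrable lborel (k q)" "(LINT r|lborel. k q r) = B"
      by (simp_all add: set_integrable_def set_lebesgue_integral_def integral_unique k_def)
  qed
  have D_int: "set_integrable lborel {0<..<s} D"
  proof (rule absolutely_integrable_imp_lborel(1))
    \<comment> \<open>The weight \<open>(s - r) powr (- a)\<close> is removed by multiplying with its bounded inverse.\<close>
    have "(\<lambda>r. (s - r) powr a *\<^sub>R (s - r) powr (- a) *\<^sub>R w' r) absolutely_integrable_on {0..s}"
    proof (rule absolutely_integrable_bounded_measurable_product
          [where h = "\<lambda>c x. c *\<^sub>R x" and f = "\<lambda>r. (s - r) powr a", OF _ _ _ _ int[OF s]])
      have *: "continuous_on {0..s} (\<lambda>r. (s - r) powr a)"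
        using a by (intro continuous_on_powr' continuous_intros) auto
      show "(\<lambda>r. (s - r) powr a) \<in> borel_measurable (lebesgue_on {0..s})"
        by (rule continuous_imp_measurable_on_sets_lebesgue[OF *]) auto
      show "bounded ((\<lambda>r. (s - r) powr a) ` {0..s})"
        by (intro compact_imp_bounded compact_continuous_image *) auto
      show "bilinear (\<lambda>(c::real) (x::'a). c *\<^sub>R x)"
        by (auto simp: bilinear_def linear_iff algebra_simps)
    qed auto
    then have "(\<lambda>r. (s - r) powr a *\<^sub>R (s - r) powr (- a) *\<^sub>R w' r) absolutely_integrable_on {0<..<s}"
      by (rule set_integrable_subset) auto
    also have "?this \<longleftrightarrow> D absolutely_integrable_on {0<..<s}"
      by (intro set_integrable_cong) (auto simp: D_def simp flip: powr_add)
    finally show "D absolutely_integrable_on {0<..<s}" by simp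
  qed measurable
  have D_total: "(LINT q:{0<..<s}|lborel. D q) = w s - w 0"
  proof -
    have "(w' has_integral w s - w 0) {0<..<s}"
      unfolding has_integral_Icc_iff_Ioo[symmetric]
      using w s by (intro fundamental_theorem_of_calculus_interior der)
                   (auto intro: continuous_on_subset)
    then have "(D has_integral w s - w 0) {0<..<s}"
      by (rule has_integral_eq[rotated]) (simp add: D_def)
    then show ?thesis
      using set_borel_integral_eq_integral(2)[OF D_int] by (simp add: integral_unique)
  qed
  have F_inner: "(LINT r|lborel. F q r) = B *\<^sub>R (indicator {0<..<s} q *\<^sub>R D q)" for q
    by (cases "q < s") (auto simp: F_def k_int)
  have F_int: "integrable (lborel \<Otimes>\<^sub>M lborel) (\<lambda>(q, r). F q r)"
  proof (rule lborel_pair.Fubini_integrable)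
    have "(LINT r|lborel. norm (F q r)) = B * norm (indicator {0<..<s} q *\<^sub>R D q)" for q
    proof -
      have "norm (F q r) = k q r * norm (indicator {0<..<s} q *\<^sub>R D q)" for r
        by (simp add: F_def k_def abs_mult indicator_def)
      then show ?thesis by (cases "q < s") (auto simp: k_int)
    qed
    then show "integrable lborel (\<lambda>q. LINT r|lborel. norm (case (q, r) of (q, r) \<Rightarrow> F q r))"
      using integrable_norm[OF D_int[unfolded set_integrable_def]]
      by (simp del: norm_scaleR)
    have "integrable lborel (F q)" for q
      by (cases "q < s") (auto simp: F_def intro!: integrable_scaleR_left k_int)
    then show "AE q in lborel. integrable lborel (\<lambda>r. case (q, r) of (q, r) \<Rightarrow> F q r)"
      by simp
  qed simp
  have F_outer: "(LINT q|lborel. F q r)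
      = indicator {0<..<s} r *\<^sub>R Gamma (1 - a) *\<^sub>R (s - r) powr (a - 1) *\<^sub>R h r" for r
  proof (cases "r \<in> {0<..<s}")
    case False
    then have "F q r = 0" for q by (auto simp: F_def k_def indicator_def)
    with False show ?thesis by simp
  next
    case True
    let ?g = "\<lambda>q. (r - q) powr (- a) *\<^sub>R w' q"
    have "?g absolutely_integrable_on {0<..<r}"
      using int[of r] True by (auto intro: set_integrable_subset)
    moreover have eq: "indicator {0<..<r} q *\<^sub>R ?g q
        = (indicator {0<..<r} q * (r - q) powr (- a)) *\<^sub>R D q" for q
      by (simp add: D_def indicator_def)
    have "(\<lambda>q. indicator {0<..<r} q *\<^sub>R ?g q) \<in> borel_measurable borel"
      unfolding eq by measurable
    ultimately have "(LINT q:{0<..<r}|lborel. ?g q) = integral {0<..<r} ?g"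
      by (rule absolutely_integrable_imp_lborel(2))
    also have "\<dots> = Gamma (1 - a) *\<^sub>R h r"
      using cap[of r] True by (simp add: abel_integral_def integral_open_interval_real)
    finally have g: "(LINT q:{0<..<r}|lborel. ?g q) = Gamma (1 - a) *\<^sub>R h r" .
    have "F q r = (s - r) powr (a - 1) *\<^sub>R (indicator {0<..<r} q *\<^sub>R ?g q)" for q
      using True by (auto simp: F_def k_def D_def indicator_def)
    then have "(LINT q|lborel. F q r) = (s - r) powr (a - 1) *\<^sub>R (LINT q:{0<..<r}|lborel. ?g q)"
      by (simp only: set_lebesgue_integral_def integral_scaleR_right)
    with True g show ?thesis by (simp add: mult_ac)
  qed
  have "integrable lborel (\<lambda>r. LINT q|lborel. F q r)"
    using lborel_pair.integrable_fst'[OF lborel_pair.integrable_product_swap[OF F_int]]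
    by (simp add: case_prod_beta)
  then have "set_integrable lborel {0<..<s}
      (\<lambda>r. Gamma (1 - a) *\<^sub>R (s - r) powr (a - 1) *\<^sub>R h r)"
    unfolding F_outer set_integrable_def .
  from set_borel_integral_eq_integral(2)[OF this]
  have "(LINT r|lborel. LINT q|lborel. F q r)
      = integral {0<..<s} (\<lambda>r. Gamma (1 - a) *\<^sub>R (s - r) powr (a - 1) *\<^sub>R h r)"
    unfolding F_outer set_lebesgue_integral_def .
  then have "(LINT r|lborel. LINT q|lborel. F q r) = Gamma (1 - a) *\<^sub>R abel_integral a h s"
    by (simp only: integral_cmul abel_integral_def integral_open_interval_real)
  moreover have "(LINT q|lborel. LINT r|lborel. F q r) = B *\<^sub>R (w s - w 0)"
    using D_total unfolding set_lebesgue_integral_def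
    by (simp only: F_inner integral_scaleR_right)
  ultimately have "B *\<^sub>R (w s - w 0) = Gamma (1 - a) *\<^sub>R abel_integral a h s"
    using lborel_pair.Fubini_integral[OF F_int] by simp
  moreover have "Gamma (1 - a) > 0" "Gamma a > 0" using a by auto
  ultimately have "Gamma (1 - a) *\<^sub>R (Gamma a *\<^sub>R (w s - w 0))
      = Gamma (1 - a) *\<^sub>R abel_integral a h s"
    by (simp add: B_def mult.commute)
  then have eq: "Gamma a *\<^sub>R (w s - w 0) = abel_integral a h s"
    using \<open>Gamma (1 - a) > 0\<close> by (simp only: scaleR_cancel_left) simp
  have "w s - w 0 = (1 / Gamma a) *\<^sub>R abel_integral a h s"
    using \<open>Gamma a > 0\<close> by (simp flip: eq)
  then show ?thesis by (simp add: algebra_simps)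
qed

section \<open>Change of the time scale\<close>

text \<open>
  The time scale \<open>\<psi>\<close> as a diffeomorphism: \<open>clock\<close> maps \<open>{l..}\<close> onto \<open>{0..}\<close>, and \<open>unclock\<close> is its inverse.
\<close>

locale time_change =
  fixes l :: real and \<psi> :: "real \<Rightarrow> real"
  assumes mono: "strict_mono_on {l..} \<psi>"
    and C1: "C1_on_halfline l \<psi>"
    and deriv_pos: "\<And>t. l \<le> t \<Longrightarrow> 0 < halfline_deriv l \<psi> t"
    and unbounded: "(SUP t\<in>{l..}. ereal (\<psi> t)) = \<infinity>"
begin

definition clock :: "real \<Rightarrow> real" where
  "clock t = \<psi> t - \<psi> l"

definition unclock :: "real \<Rightarrow> real" where
  "unclock = inv_into {l..} clock"

lemma has_derivative_clock:
  assumes "l \<le> t"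
  shows "(clock has_field_derivative halfline_deriv l \<psi> t) (at t within {l..})"
proof -
  have "\<psi> differentiable at t within {l..}"
    using C1 assms by (auto simp: C1_on_halfline_def differentiable_on_def)
  then have "(\<psi> has_vector_derivative halfline_deriv l \<psi> t) (at t within {l..})"
    by (simp add: halfline_deriv_def vector_derivative_works)
  then show ?thesis
    unfolding clock_def has_real_derivative_iff_has_vector_derivative
    by (auto intro!: derivative_eq_intros)
qed

lemma continuous_on_clock: "continuous_on {l..} clock"
  using has_derivative_clock DERIV_continuous_on by (metis atLeast_iff)

lemma strict_mono_clock: "strict_mono_on {l..} clock"
  using mono by (auto simp: clock_def strict_mono_on_def)

lemma inj_clock: "inj_on clock {l..}"
  by (rule strict_mono_on_imp_inj_on[OF strict_mono_clock])

lemma clock_l [simp]: "clock l = 0"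
  by (simp add: clock_def)

lemma clock_le_iff: "l \<le> t \<Longrightarrow> l \<le> u \<Longrightarrow> clock t \<le> clock u \<longleftrightarrow> t \<le> u"
  using strict_mono_clock by (simp add: strict_mono_on_leD strict_mono_on_less_eq)

lemma clock_image_Icc:
  assumes "l \<le> t"
  shows "clock ` {l..t} = {0..clock t}"
proof
  show "clock ` {l..t} \<subseteq> {0..clock t}"
    using clock_le_iff[of l] clock_le_iff[of _ t] assms by auto
  show "{0..clock t} \<subseteq> clock ` {l..t}"
  proof
    fix s assume "s \<in> {0..clock t}"
    then obtain u where "l \<le> u" "u \<le> t" "clock u = s"
      using IVT'[of clock l s t] assms continuous_on_subset[OF continuous_on_clock, of "{l..t}"] by auto
    then show "s \<in> clock ` {l..t}" by auto
  qed
qed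

lemma clock_unbounded: "\<exists>t\<ge>l. s < clock t"
proof -
  have "ereal (s + \<psi> l) < (SUP t\<in>{l..}. ereal (\<psi> t))" by (simp add: unbounded)
  then show ?thesis by (auto simp: less_SUP_iff clock_def algebra_simps)
qed

lemma clock_image: "clock ` {l..} = {0..}"
proof
  show "clock ` {l..} \<subseteq> {0..}" using clock_le_iff[of l] by auto
  show "{0..} \<subseteq> clock ` {l..}"
  proof
    fix s :: real assume "s \<in> {0..}"
    moreover obtain t where "l \<le> t" "s < clock t" using clock_unbounded by blast
    ultimately show "s \<in> clock ` {l..}" using clock_image_Icc[of t] by force
  qed
qed

lemma unclock_clock [simp]: "l \<le> t \<Longrightarrow> unclock (clock t) = t"
  by (simp add: unclock_def inj_clock)

lemma
  assumes "0 \<le> s"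
  shows clock_unclock [simp]: "clock (unclock s) = s" and unclock_ge: "l \<le> unclock s"
  using assms clock_image f_inv_into_f[of s clock "{l..}"] inv_into_into[of s clock "{l..}"]
  by (auto simp: unclock_def)

lemma unclock_gt: "0 < s \<Longrightarrow> l < unclock s"
  using unclock_ge[of s] clock_unclock[of s] by (cases "unclock s = l") auto

text \<open>
  The inverse of a continuous injection is continuous on compact images; continuity on the
  half-line follows because each point has a neighbourhood inside some \<open>{0..clock t}\<close>.
\<close>

lemma continuous_on_unclock: "continuous_on {0..} unclock"
  unfolding continuous_on_eq_continuous_within
proof
  fix s :: real assume s: "s \<in> {0..}"
  obtain t where t: "l \<le> t" "s < clock t" using clock_unbounded by blast
  have "continuous_on (clock ` {l..t}) unclock"
    by (intro continuous_on_inv continuous_on_subset[OF continuous_on_clock]) auto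
  then have "continuous (at s within {0..clock t}) unclock"
    using s t by (simp add: clock_image_Icc continuous_on_eq_continuous_within)
  moreover have "at s within {0..clock t} = at s within {0..}"
    using s t by (intro at_within_nhd[where S = "{..<clock t}"]) auto
  ultimately show "continuous (at s within {0..}) unclock" by simp
qed

lemma has_derivative_unclock:
  assumes "0 < s"
  shows "(unclock has_vector_derivative 1 / halfline_deriv l \<psi> (unclock s)) (at s)"
proof -
  have "at (unclock s) within {l..} = at (unclock s)"
    using unclock_gt[OF assms] by (intro at_within_interior) (simp add: interior_real_atLeast)
  then have "DERIV clock (unclock s) :> halfline_deriv l \<psi> (unclock s)"
    using has_derivative_clock[OF unclock_ge[of s]] assms by simp
  moreover have "isCont unclock s"
    using continuous_on_unclock assms
    by (intro continuous_on_interior[where S = "{0..}"]) (simp_all add: interior_real_atLeast)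
  ultimately have "DERIV unclock s :> inverse (halfline_deriv l \<psi> (unclock s))"
    using assms deriv_pos[OF unclock_ge[of s]]
    by (intro DERIV_inverse_function[where f = clock and a = 0 and b = "s + 1"]) auto
  then show ?thesis
    by (simp add: has_real_derivative_iff_has_vector_derivative divide_inverse)
qed

text \<open>
  The factor \<open>\<psi>'\<close> of the integrand is the Jacobian of the substitution \<open>r = clock \<tau>\<close>. Integrability
  is needed for the second part because the Lebesgue integral of a non-integrable function is \<open>0\<close>,
  whereas the gauge integral in \<open>abel_integral\<close> may then still have another value.
\<close>

lemma psi_RL_change_of_variables:
  fixes x :: "real \<Rightarrow> 'a::euclidean_space" and \<gamma> :: real
  assumes t: "l \<le> t"
  defines "k \<equiv> \<lambda>r. (clock t - r) powr (\<gamma> - 1) *\<^sub>R x (unclock r)"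
  shows psi_RL_integrable_iff:
      "psi_RL_integrand l \<psi> \<gamma> x t absolutely_integrable_on {l..t}
        \<longleftrightarrow> k absolutely_integrable_on {0..clock t}"
    and psi_RL_integral_eq_abel:
      "k absolutely_integrable_on {0..clock t} \<Longrightarrow>
        psi_RL_integral l \<psi> \<gamma> x t
          = (1 / Gamma \<gamma>) *\<^sub>R abel_integral \<gamma> (\<lambda>r. x (unclock r)) (clock t)"
proof -
  let ?I = "psi_RL_integrand l \<psi> \<gamma> x t" and ?d = "halfline_deriv l \<psi>"
  have eq: "\<bar>?d \<tau>\<bar> *\<^sub>R k (clock \<tau>) = ?I \<tau>" if "\<tau> \<in> {l..t}" for \<tau>
    using that deriv_pos[of \<tau>] by (simp add: k_def psi_RL_integrand_def clock_def[of t] mult.commute)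
      (simp add: clock_def)
  have cv: "(\<lambda>\<tau>. \<bar>?d \<tau>\<bar> *\<^sub>R k (clock \<tau>)) absolutely_integrable_on {l..t}
        \<and> integral {l..t} (\<lambda>\<tau>. \<bar>?d \<tau>\<bar> *\<^sub>R k (clock \<tau>)) = b
      \<longleftrightarrow> k absolutely_integrable_on clock ` {l..t} \<and> integral (clock ` {l..t}) k = b" for b
    by (intro has_absolute_integral_change_of_variables_real)
      (auto intro: has_field_derivative_subset[OF has_derivative_clock] inj_on_subset[OF inj_clock])
  have "(\<lambda>\<tau>. \<bar>?d \<tau>\<bar> *\<^sub>R k (clock \<tau>)) absolutely_integrable_on {l..t} \<longleftrightarrow> ?I absolutely_integrable_on {l..t}"
    by (intro set_integrable_cong) (auto simp: eq)
  moreover have "integral {l..t} (\<lambda>\<tau>. \<bar>?d \<tau>\<bar> *\<^sub>R k (clock \<tau>)) = integral {l..t} ?I"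
    by (intro integral_cong eq)
  ultimately have cv': "?I absolutely_integrable_on {l..t} \<and> integral {l..t} ?I = b
      \<longleftrightarrow> k absolutely_integrable_on {0..clock t} \<and> integral {0..clock t} k = b" for b
    using cv[of b] clock_image_Icc[OF t] by simp
  show iff: "?I absolutely_integrable_on {l..t} \<longleftrightarrow> k absolutely_integrable_on {0..clock t}"
    using cv' by blast
  assume k: "k absolutely_integrable_on {0..clock t}"
  then have "?I absolutely_integrable_on {l..t}" "integral {l..t} ?I = integral {0..clock t} k"
    using cv' by blast+
  then show "psi_RL_integral l \<psi> \<gamma> x t
      = (1 / Gamma \<gamma>) *\<^sub>R abel_integral \<gamma> (\<lambda>r. x (unclock r)) (clock t)"
    by (simp add: psi_RL_integral_def set_lebesgue_integral_eq_integral(2) abel_integral_def k_def)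
qed

lemma continuous_on_unclock_compose:
  assumes "continuous_on {l..} x"
  shows "continuous_on {0..} (\<lambda>s. x (unclock s))"
  by (rule continuous_on_compose2[OF assms continuous_on_unclock]) (auto intro: unclock_ge)

lemma integral_solution_unclock:
  fixes z :: "real \<Rightarrow> 'a::euclidean_space"
  assumes a: "0 < \<alpha>" and g: "continuous_on UNIV g"
    and sol: "is_integral_solution l \<psi> \<alpha> \<beta> g z\<^sub>0 z" and s: "0 \<le> s"
  shows "z (unclock s) = z\<^sub>0 - (\<beta> / Gamma \<alpha>) *\<^sub>R abel_integral \<alpha> (\<lambda>r. g (z (unclock r))) s"
proof -
  have "continuous_on {l..} z" using sol by (simp add: is_integral_solution_def)
  then have "continuous_on {0..s} (\<lambda>r. g (z (unclock r)))"
    by (intro continuous_on_compose2[OF g] continuous_on_subset[OF continuous_on_unclock_compose]) auto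
  from abel_integrand_absolutely_integrable[OF a s this]
  have "psi_RL_integral l \<psi> \<alpha> (\<lambda>t. g (z t)) (unclock s)
      = (1 / Gamma \<alpha>) *\<^sub>R abel_integral \<alpha> (\<lambda>r. g (z (unclock r))) s"
    using psi_RL_integral_eq_abel[of "unclock s" \<alpha> "\<lambda>t. g (z t)"] unclock_ge s by simp
  then show ?thesis using sol unclock_ge[OF s] by (simp add: is_integral_solution_def)
qed

text \<open>
  By the chain rule, \<open>J_psi\<close> is ordinary differentiation in the new time, so the Caputo equation
  becomes the hypothesis \<open>cap\<close> of \<open>caputo_imp_volterra\<close>.
\<close>

lemma Caputo_solution_unclock:
  fixes z :: "real \<Rightarrow> 'a::euclidean_space"
  assumes a: "0 < \<alpha>" "\<alpha> < 1"
    and sol: "is_Caputo_solution l \<psi> \<alpha> \<beta> g z\<^sub>0 z" and s: "0 \<le> s"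
  shows "z (unclock s) = z\<^sub>0 - (\<beta> / Gamma \<alpha>) *\<^sub>R abel_integral \<alpha> (\<lambda>r. g (z (unclock r))) s"
proof -
  have z: "continuous_on {l..} z" "z l = z\<^sub>0"
    and ex: "\<And>t. l < t \<Longrightarrow> psi_Caputo_deriv_exists l \<psi> \<alpha> z t"
    and eq: "\<And>t. l < t \<Longrightarrow> psi_Caputo_deriv l \<psi> \<alpha> z t = - (\<beta> *\<^sub>R g (z t))"
    using sol by (auto simp: is_Caputo_solution_def)
  let ?w' = "\<lambda>r. J_psi l \<psi> z (unclock r)"
  have der: "((\<lambda>s. z (unclock s)) has_vector_derivative ?w' r) (at r)" if r: "0 < r" for r
  proof -
    let ?t = "unclock r"
    have t: "l < ?t" using unclock_gt[OF r] .
    then have "z differentiable_on {l<..?t + 1}"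
      using ex[of "?t + 1"] by (simp add: psi_Caputo_deriv_exists_def)
    moreover have "at ?t within {l<..?t + 1} = at ?t" "at ?t within {l..} = at ?t"
      using t by (auto intro!: at_within_interior simp: interior_real_atLeast
          intro: interiorI[where T = "{l<..<?t + 1}"])
    ultimately have "(z has_vector_derivative halfline_deriv l z ?t) (at ?t)"
      using t by (auto simp: differentiable_on_def halfline_deriv_def vector_derivative_works
          dest!: bspec[where x = ?t])
    from vector_diff_chain_at[OF has_derivative_unclock[OF r] this]
    show ?thesis by (simp add: o_def J_psi_def)
  qed
  have int: "(\<lambda>q. (r - q) powr (- \<alpha>) *\<^sub>R ?w' q) absolutely_integrable_on {0..r}" if r: "0 < r" for r
    using ex[OF unclock_gt[OF r]] r unclock_ge[of r]
    by (simp add: psi_Caputo_deriv_exists_def psi_RL_integrable_iff)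
  have cap: "abel_integral (1 - \<alpha>) ?w' r = Gamma (1 - \<alpha>) *\<^sub>R - (\<beta> *\<^sub>R g (z (unclock r)))"
    if r: "0 < r" for r
  proof -
    have "- (\<beta> *\<^sub>R g (z (unclock r))) = (1 / Gamma (1 - \<alpha>)) *\<^sub>R abel_integral (1 - \<alpha>) ?w' r"
      using eq[OF unclock_gt[OF r]] psi_RL_integral_eq_abel[of "unclock r" "1 - \<alpha>" "J_psi l \<psi> z"]
        int[OF r] r unclock_ge[of r]
      by (simp add: psi_Caputo_deriv_def)
    moreover have "Gamma (1 - \<alpha>) > 0" using a by auto
    ultimately show ?thesis by simp
  qed
  have "unclock 0 = l" using unclock_clock[of l] by simp
  with caputo_imp_volterra[OF a continuous_on_unclock_compose[OF z(1)] der int cap s] z(2)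
  have "z (unclock s) = z\<^sub>0
      + (1 / Gamma \<alpha>) *\<^sub>R abel_integral \<alpha> (\<lambda>r. - (\<beta> *\<^sub>R g (z (unclock r)))) s"
    by simp
  also have "abel_integral \<alpha> (\<lambda>r. - (\<beta> *\<^sub>R g (z (unclock r)))) s
      = - \<beta> *\<^sub>R abel_integral \<alpha> (\<lambda>r. g (z (unclock r))) s"
    by (simp add: abel_integral_scaleR flip: scaleR_minus_left)
  finally show ?thesis by simp
qed

text \<open>
  The asymptotic bound holds from some time on; before that time, the ratio of \<open>norm (z t - y)\<close> to
  the exponential is continuous on a compact interval and hence bounded.
\<close>

lemma decay_imp_unclock_bound:
  fixes z :: "real \<Rightarrow> 'a::euclidean_space"
  assumes z: "continuous_on {l..} z"
    and decay: "(\<lambda>t. norm (z t - y)) \<in> O[at_top](\<lambda>t. exp (- \<omega> * \<psi> t))"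
  obtains M where "\<And>s. 0 \<le> s \<Longrightarrow> norm (z (unclock s) - y) \<le> M * exp (- \<omega> * s)"
proof -
  obtain c T where T: "\<And>t. T \<le> t \<Longrightarrow> norm (z t - y) \<le> c * exp (- \<omega> * \<psi> t)"
    using decay by (auto simp: bigo_def eventually_at_top_linorder)
  let ?q = "\<lambda>t. exp (\<omega> * clock t) * norm (z t - y)"
  have "continuous_on {l..max l T} ?q"
    using z continuous_on_clock by (intro continuous_intros) (auto intro: continuous_on_subset)
  then have "bounded (?q ` {l..max l T})"
    by (intro compact_imp_bounded compact_continuous_image) auto
  then obtain m where m: "\<forall>t\<in>{l..max l T}. ?q t \<le> m"
    by (auto simp: bounded_iff)
  \<comment> \<open>\<open>exp (- \<omega> * \<psi> t) = exp (- \<omega> * \<psi> l) * exp (- \<omega> * clock t)\<close> accounts for the second constant.\<close>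
  define M where "M = max m (c * exp (- \<omega> * \<psi> l))"
  have "norm (z t - y) \<le> M * exp (- \<omega> * clock t)" if t: "l \<le> t" for t
  proof (cases "T \<le> t")
    case True
    have "norm (z t - y) \<le> c * exp (- \<omega> * \<psi> l) * exp (- \<omega> * clock t)"
      using T[OF True] by (simp add: clock_def algebra_simps flip: exp_add)
    also have "\<dots> \<le> M * exp (- \<omega> * clock t)" unfolding M_def by (intro mult_right_mono) auto
    finally show ?thesis .
  next
    case False
    then have "?q t \<le> M" using m t by (auto simp: M_def le_max_iff_disj)
    then show ?thesis by (simp add: exp_minus field_simps)
  qed
  with unclock_ge clock_unclock show ?thesis by (intro that[of M]) force
qed

end

section \<open>Absence of exponential convergence\<close>

theorem theorem5p3:
  fixes \<alpha> \<beta> l L\<^sub>f :: real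
    and f :: "real ^ 'd \<Rightarrow> real"
    and grad_f :: "real ^ 'd \<Rightarrow> real ^ 'd"
    and \<psi> :: "real \<Rightarrow> real"
    and z :: "real \<Rightarrow> real ^ 'd"
    and z\<^sub>0 :: "real ^ 'd"
  assumes "0 < \<alpha>" and "\<alpha> < 1" and "0 \<le> l" and "0 < \<beta>"
    and "\<And>x. GDERIV f x :> grad_f x"
    and "continuous_on UNIV grad_f"
    and "0 < L\<^sub>f"
    and "\<And>x y. norm (grad_f x - grad_f y) \<le> L\<^sub>f * norm (x - y)"
    and "\<And>t. l \<le> t \<Longrightarrow> 0 \<le> \<psi> t"
    and "strict_mono_on {l..} \<psi>"
    and "C1_on_halfline l \<psi>"
    and "\<And>t. l \<le> t \<Longrightarrow> 0 < halfline_deriv l \<psi> t"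
    and "(SUP t\<in>{l..}. ereal (\<psi> t)) = \<infinity>"
    and "is_Caputo_solution l \<psi> \<alpha> \<beta> grad_f z\<^sub>0 z \<or> is_integral_solution l \<psi> \<alpha> \<beta> grad_f z\<^sub>0 z"
    and "\<not> z constant_on {l..}"
  shows "\<nexists>y \<omega>. grad_f y = 0 \<and> 0 < \<omega> \<and>
           (\<lambda>t. norm (z t - y)) \<in> O[at_top](\<lambda>t. exp (- \<omega> * \<psi> t))"
proof (intro notI, elim exE conjE)
  fix y \<omega>
  assume y: "grad_f y = 0" and \<omega>: "0 < \<omega>"
    and decay: "(\<lambda>t. norm (z t - y)) \<in> O[at_top](\<lambda>t. exp (- \<omega> * \<psi> t))"
  interpret time_change l \<psi> by unfold_locales fact+
  have z: "continuous_on {l..} z"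
    using assms(14) by (auto simp: is_Caputo_solution_def is_integral_solution_def)
  let ?w = "\<lambda>s. z (unclock s) - y"
  let ?h = "\<lambda>s. - (\<beta> / Gamma \<alpha>) *\<^sub>R grad_f (z (unclock s))"
  have w: "continuous_on {0..} ?w" and h: "continuous_on {0..} ?h"
    using continuous_on_unclock_compose[OF z]
    by (auto intro!: continuous_intros continuous_on_compose2[OF assms(6)])
  have "Gamma \<alpha> > 0" using assms(1) by auto
  \<comment> \<open>Here the stationarity of \<open>y\<close> enters: \<open>grad_f\<close> at \<open>z\<close> is its difference to \<open>grad_f y = 0\<close>.\<close>
  then have hw: "norm (?h s) \<le> \<beta> / Gamma \<alpha> * L\<^sub>f * norm (?w s)" for s
    using assms(8)[of "z (unclock s)" y] \<open>0 < \<beta>\<close> y by (simp add: divide_simps mult.assoc)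
  have volterra: "?w s = (z\<^sub>0 - y) + abel_integral \<alpha> ?h s" if "0 \<le> s" for s
    using assms(14) that Caputo_solution_unclock[OF assms(1,2), of \<beta> grad_f z\<^sub>0 z s]
      integral_solution_unclock[OF assms(1,6), of \<beta> z\<^sub>0 z s]
    by (auto simp: abel_integral_scaleR simp flip: scaleR_minus_left)
  obtain M where bound: "\<And>s. 0 \<le> s \<Longrightarrow> norm (?w s) \<le> M * exp (- \<omega> * s)"
    using decay_imp_unclock_bound[OF z decay] by blast
  have w0: "?w s = 0" if "0 \<le> s" for s
    by (rule volterra_exp_decay_zero[OF assms(1,2) \<omega> w h hw volterra bound that])
  have "z t = y" if "l \<le> t" for t
    using w0[of "clock t"] clock_le_iff[of l t] that by simp
  then show False using assms(15) by (auto simp: constant_on_def)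
qed

end
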